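(* For an integer $n\geq 3$, let $P_n$ denote a regular $n$-gon in the Euclidean plane with all sides of length $1$. Then: (a) For $n=5$, there is no point in the plane of $P_5$ whose distance to each vertex of $P_5$ is a rational number. (b) For $n=6$, there exists a point in the plane of $P_6$ whose distance to each vertex of $P_6$ is a rational number. (c) For every integer $n\geq 7$ with $n\notin\{8,12,24\}$, there is no point in the plane of $P_n$ whose distance to each vertex of $P_n$ is a rational number. *)

theory Defs
  imports Complex_Main
begin

text \<open>The Euclidean plane is the type of complex numbers, with its metric \<^const>\<open>dist\<close>.
  A regular \<open>n\<close>-gon is given by its vertices \<open>P 0, \<dots>, P (n - 1)\<close> in cyclic order, equally
  spaced on a circle with arbitrary centre \<open>c\<close>, radius \<open>r\<close> and phase \<open>t\<close>. The values \<open>P k\<close> for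
  \<open>k \<ge> n\<close> are irrelevant.\<close>

definition regular_polygon :: "nat \<Rightarrow> (nat \<Rightarrow> complex) \<Rightarrow> bool" where
  "regular_polygon n P \<longleftrightarrow> n \<ge> 3 \<and>
     (\<exists>c r t. r > 0 \<and> (\<forall>k<n. P k = c + of_real r * cis (t + 2 * pi * real k / real n)))"

definition unit_regular_polygon :: "nat \<Rightarrow> (nat \<Rightarrow> complex) \<Rightarrow> bool" where
  "unit_regular_polygon n P \<longleftrightarrow> regular_polygon n P \<and>
     (\<forall>k<n. dist (P k) (P (Suc k mod n)) = 1)"

definition rational_distance_point :: "nat \<Rightarrow> (nat \<Rightarrow> complex) \<Rightarrow> complex \<Rightarrow> bool" where
  "rational_distance_point n P x \<longleftrightarrow> (\<forall>k<n. dist x (P k) \<in> \<rat>)"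

lemma norm_cis_minus_one: "norm (1 - cis a) = 2 * \<bar>sin (a / 2)\<bar>"
proof -
  have "(norm (1 - cis a))\<^sup>2 = (1 - cos a)\<^sup>2 + (sin a)\<^sup>2"
    by (simp add: cmod_power2)
  also have "\<dots> = 2 - 2 * cos a"
    using sin_cos_squared_add[of a] by (simp add: power2_eq_square algebra_simps)
  also have "\<dots> = (2 * \<bar>sin (a / 2)\<bar>)\<^sup>2"
    using cos_double_sin[of "a / 2"] by (simp add: power_mult_distrib)
  finally show ?thesis
    by (rule power2_eq_imp_eq) simp_all
qed

lemma unit_regular_polygon_exists:
  assumes "n \<ge> 3"
  shows "\<exists>P. unit_regular_polygon n P"
proof -
  define r where "r = 1 / (2 * sin (pi / real n))"
  define P where "P = (\<lambda>k. of_real r * cis (2 * pi * real k / real n))"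
  have s: "sin (pi / real n) > 0"
    using assms by (intro sin_gt_zero) (auto simp: field_simps)
  then have r: "r > 0" by (simp add: r_def)
  have reg: "regular_polygon n P"
    unfolding regular_polygon_def using assms r
    by (intro conjI exI[of _ 0] exI[of _ r]) (auto simp: P_def)
  have "dist (P k) (P (Suc k mod n)) = 1" if "k < n" for k
  proof -
    have per: "P (Suc k mod n) = P (Suc k)"
    proof (cases "Suc k = n")
      case True
      have "P n = P 0" using assms by (simp add: P_def)
      with True show ?thesis by simp
    next
      case False
      with that show ?thesis by simp
    qed
    have "cis (2 * pi * real (Suc k) / real n) = cis (2 * pi * real k / real n) * cis (2 * pi / real n)"
      by (simp add: cis_mult add_divide_distrib algebra_simps)
    then have "P k - P (Suc k) = of_real r * cis (2 * pi * real k / real n) * (1 - cis (2 * pi / real n))"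
      by (simp only: P_def) (simp add: algebra_simps)
    then have "dist (P k) (P (Suc k)) = r * (2 * \<bar>sin (pi / real n)\<bar>)"
      using r by (simp add: dist_norm norm_mult norm_cis_minus_one)
    with per s show ?thesis by (simp add: r_def)
  qed
  with reg show ?thesis unfolding unit_regular_polygon_def by blast
qed

end

theory Submission
  imports Defs
begin

text \<open>
  Put \<open>\<theta> = 2\<pi>/n\<close>. The squared distance from a point to the \<open>k\<close>-th vertex is \<open>s - c\<^sub>k\<close>, where \<open>s\<close>
  does not depend on \<open>k\<close> and \<open>c\<^sub>k\<^sub>-\<^sub>1 + c\<^sub>k\<^sub>+\<^sub>1 = 2 cos \<theta> c\<^sub>k\<close>. The differences of the squared distances
  obey the same recurrence. If all distances are rational and \<open>cos \<theta>\<close> is irrational, two consecutive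
  differences must therefore vanish, so the point is the centre and the circumradius \<open>r\<close> is
  rational. But a unit side means \<open>2 r\<^sup>2 (1 - cos \<theta>) = 1\<close>, which makes \<open>cos \<theta>\<close> rational after all.
  Finally, if \<open>2 cos \<theta> = a/b\<close> in lowest terms, then \<open>b\<^sup>k \<cdot> 2 cos (k\<theta>)\<close> is an integer congruent to
  \<open>a\<^sup>k\<close> modulo \<open>b\<close>; for \<open>k = n\<close> this integer is \<open>2 b\<^sup>n\<close>, so \<open>b\<close> divides \<open>a\<^sup>n\<close> and \<open>b = 1\<close>. So
  \<open>2 cos (2\<pi>/n)\<close> is irrational unless it is an integer, which it is not for \<open>n = 5\<close> and \<open>n \<ge> 7\<close>. For the hexagon \<open>r = 1\<close>, and the centre is a solution.
\<close>

lemma cos_add_cos_diff: "cos (x + y) + cos (x - y) = 2 * cos y * cos (x::real)"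
  by (simp add: cos_add cos_diff)

lemma sin_add_sin_diff: "sin (x + y) + sin (x - y) = 2 * cos y * sin (x::real)"
  by (simp add: sin_add sin_diff)

text \<open>Induction along the three-term recurrence for \<open>cos (k * \<theta>)\<close>. Indices
  start at \<open>Suc k\<close>: at index 0 the integer would be 2, which need not be congruent to
  \<open>a ^ 0 = 1\<close>.\<close>

lemma two_cos_multiple_numerator:
  fixes a b :: int and \<theta> :: real
  assumes "of_int b * (2 * cos \<theta>) = of_int a"
  shows "\<exists>u. of_int u = of_int b ^ Suc k * (2 * cos (real (Suc k) * \<theta>)) \<and> b dvd u - a ^ Suc k"
proof (induction k rule: induct_nat_012)
  case 0
  show ?case
    using assms by (intro exI[of _ a]) simp
next
  case 1
  have "of_int (a\<^sup>2 - 2 * b\<^sup>2) = of_int b ^ 2 * (2 * cos (2 * \<theta>))"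
    by (simp only: cos_double_cos assms[symmetric] of_int_diff of_int_mult of_int_power of_int_numeral)
      (simp add: power2_eq_square algebra_simps)
  moreover have "b dvd (a\<^sup>2 - 2 * b\<^sup>2) - a\<^sup>2"
    by (simp add: power2_eq_square)
  ultimately show ?case
    by (intro exI[of _ "a\<^sup>2 - 2 * b\<^sup>2"]) (simp add: numeral_2_eq_2)
next
  case (ge2 k)
  from ge2(1) obtain u where
    u: "of_int u = of_int b ^ Suc k * (2 * cos (real (Suc k) * \<theta>))" by blast
  from ge2(2) obtain v where
    v: "of_int v = of_int b ^ Suc (Suc k) * (2 * cos (real (Suc (Suc k)) * \<theta>))"
    and dv: "b dvd v - a ^ Suc (Suc k)" by blast
  \<comment> \<open>The cosine recurrence scaled by \<open>b ^ (k + 3)\<close>: one factor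
    \<open>b\<close> turns \<open>2 * cos \<theta>\<close> into \<open>a\<close>, and the older term
    keeps \<open>b\<^sup>2\<close>. Modulo \<open>b\<close> this is multiplication by
    \<open>a\<close>.\<close>
  define w where "w = a * v - b\<^sup>2 * u"
  have *: "cos (real (Suc (Suc (Suc k))) * \<theta>) =
      2 * cos \<theta> * cos (real (Suc (Suc k)) * \<theta>) - cos (real (Suc k) * \<theta>)"
    using cos_add_cos_diff[of "real (Suc (Suc k)) * \<theta>" \<theta>] by (simp add: algebra_simps)
  have "of_int w = of_int a * of_int v - of_int b ^ 2 * (of_int u :: real)"
    by (simp add: w_def)
  also have "\<dots> = of_int b ^ Suc (Suc (Suc k)) * (2 * cos (real (Suc (Suc (Suc k))) * \<theta>))"
    unfolding * u v assms[symmetric] by (simp add: power2_eq_square algebra_simps)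
  finally have "of_int w = of_int b ^ Suc (Suc (Suc k)) * (2 * cos (real (Suc (Suc (Suc k))) * \<theta>))" .
  moreover have "w - a ^ Suc (Suc (Suc k)) = a * (v - a ^ Suc (Suc k)) - b * (b * u)"
    by (simp add: w_def power2_eq_square algebra_simps)
  then have "b dvd w - a ^ Suc (Suc (Suc k))"
    using dv by simp
  ultimately show ?case by blast
qed

lemma rational_two_cos_integer:
  assumes n: "n > 0" and rat: "2 * cos (2 * pi / real n) \<in> \<rat>"
  shows "2 * cos (2 * pi / real n) \<in> \<int>"
proof -
  from rat obtain q where q: "2 * cos (2 * pi / real n) = of_rat q"
    by (auto elim: Rats_cases)
  obtain a b where ab: "quotient_of q = (a, b)" by fastforce
  then have b: "b > 0" and co: "coprime a b"
    by (auto intro: quotient_of_denom_pos quotient_of_coprime)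
  from ab have "q = of_int a / of_int b" by (rule quotient_of_div)
  with q have q': "2 * cos (2 * pi / real n) = of_int a / of_int b"
    by (simp add: of_rat_divide)
  then have "of_int b * (2 * cos (2 * pi / real n)) = of_int a"
    using b by simp
  \<comment> \<open>At index \<open>n\<close> the angle is a full turn, which forces
    \<open>u = 2 * b ^ n\<close>.\<close>
  from two_cos_multiple_numerator[OF this, of "n - 1"] n obtain u
    where u: "of_int u = of_int b ^ n * (2 * cos (real n * (2 * pi / real n)))"
      and du: "b dvd u - a ^ n"
    by auto
  from u n have "real_of_int u = of_int (2 * b ^ n)" by simp
  then have "u = 2 * b ^ n" by (simp only: of_int_eq_iff)
  then have "b dvd u" using n by simp
  with du have "b dvd a ^ n" by (simp add: dvd_diff_right_iff)
  moreover have "coprime (a ^ n) b" using co by simp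
  ultimately have "is_unit b" by (meson coprime_common_divisor dvd_refl)
  with b have "b = 1" by simp
  with q' show ?thesis by simp
qed

text \<open>The value lies strictly between consecutive integers: the angle is in (pi/3, pi/2) for
  \<open>n = 5\<close>, giving (0, 1), and in (0, pi/3) for \<open>n \<ge> 7\<close>, giving (1,
  2).\<close>

lemma two_cos_irrational:
  assumes "n \<ge> 5" "n \<noteq> 6"
  shows "2 * cos (2 * pi / real n) \<notin> \<rat>"
proof
  assume "2 * cos (2 * pi / real n) \<in> \<rat>"
  then have "2 * cos (2 * pi / real n) \<in> \<int>"
    using assms by (intro rational_two_cos_integer) auto
  then obtain m where m: "2 * cos (2 * pi / real n) = of_int m"
    by (auto elim: Ints_cases)
  consider "n = 5" | "n \<ge> 7" using assms by linarith
  then show False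
  proof cases
    case 1
    have "cos (2 * pi / real n) > 0"
      using 1 by (intro cos_gt_zero) auto
    moreover have "cos (2 * pi / real n) < cos (pi / 3)"
      using 1 by (intro cos_monotone_0_pi) auto
    ultimately have "0 < real_of_int m" "real_of_int m < 1"
      using m by (auto simp: cos_60)
    then show False by simp
  next
    case 2
    have "cos (2 * pi / real n) < cos 0"
      using 2 by (intro cos_monotone_0_pi) (auto simp: field_simps)
    moreover have "cos (pi / 3) < cos (2 * pi / real n)"
      using 2 by (intro cos_monotone_0_pi) (auto simp: field_simps)
    ultimately have "1 < real_of_int m" "real_of_int m < 2"
      using m by (auto simp: cos_60)
    then show False by simp
  qed
qed

text \<open>The last equation is the law of cosines in the triangle formed by the centre and two
  adjacent vertices.\<close>

lemma unit_regular_polygonE: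
  assumes "unit_regular_polygon n P"
  obtains c r t where "r > 0" "\<And>k. k < n \<Longrightarrow> P k = c + of_real r * cis (t + real k * (2 * pi / real n))"
    "2 * r\<^sup>2 * (1 - cos (2 * pi / real n)) = 1"
proof -
  define \<theta> where "\<theta> = 2 * pi / real n"
  from assms obtain c r t where n: "n \<ge> 3" and r: "r > 0"
    and P: "\<And>k. k < n \<Longrightarrow> P k = c + of_real r * cis (t + real k * \<theta>)"
    and d: "\<And>k. k < n \<Longrightarrow> dist (P k) (P (Suc k mod n)) = 1"
    unfolding unit_regular_polygon_def regular_polygon_def \<theta>_def by (auto simp: algebra_simps)
  have "P 0 - P 1 = of_real r * cis t * (1 - cis \<theta>)"
    using P[of 0] P[of 1] n by (simp add: cis_mult[symmetric] algebra_simps)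
  moreover have "dist (P 0) (P 1) = 1"
    using d[of 0] n by simp
  ultimately have "r * norm (1 - cis \<theta>) = 1"
    using r by (simp add: dist_norm norm_mult)
  then have "1 = r\<^sup>2 * (norm (1 - cis \<theta>))\<^sup>2"
    by (metis power_mult_distrib power_one)
  also have "(norm (1 - cis \<theta>))\<^sup>2 = 2 * (1 - cos \<theta>)"
    using cos_double_sin[of "\<theta> / 2"] by (simp add: norm_cis_minus_one power_mult_distrib)
  finally have "2 * r\<^sup>2 * (1 - cos \<theta>) = 1" by (simp add: algebra_simps)
  with that r P show thesis unfolding \<theta>_def by blast
qed

lemma rational_recurrence_middle_zero:
  fixes \<alpha> :: real
  assumes "\<alpha> \<notin> \<rat>" "x \<in> \<rat>" "y \<in> \<rat>" "z \<in> \<rat>" "x + z = \<alpha> * y"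
  shows "y = 0"
proof (rule ccontr)
  assume "y \<noteq> 0"
  with assms(5) have "\<alpha> = (x + z) / y" by simp
  moreover have "(x + z) / y \<in> \<rat>" using assms(2-4) by simp
  ultimately show False using assms(1) by simp
qed

lemma no_rational_distance_point:
  assumes "n \<ge> 5" "n \<noteq> 6" "unit_regular_polygon n P"
  shows "\<not> rational_distance_point n P x"
proof
  assume rat: "rational_distance_point n P x"
  define \<theta> where "\<theta> = 2 * pi / real n"
  from assms(3) obtain c r t where r: "r > 0"
    and P: "\<And>k. k < n \<Longrightarrow> P k = c + of_real r * cis (t + real k * \<theta>)"
    and side: "2 * r\<^sup>2 * (1 - cos \<theta>) = 1"
    unfolding \<theta>_def by (rule unit_regular_polygonE) blast
  have irr: "2 * cos \<theta> \<notin> \<rat>"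
    using two_cos_irrational assms unfolding \<theta>_def by simp
  \<comment> \<open>\<open>r * f k\<close> is the inner product of \<open>x - c\<close> with the
    vector from the centre to vertex \<open>k\<close>, so \<open>D k\<close> is the squared
    distance. Both make sense for all \<open>k\<close>, so the recurrences need no index
    bound.\<close>
  define f where "f = (\<lambda>k. Re (x - c) * cos (t + real k * \<theta>) + Im (x - c) * sin (t + real k * \<theta>))"
  define D where "D = (\<lambda>k. (norm (x - c))\<^sup>2 + r\<^sup>2 - 2 * r * f k)"
  have f_rec: "f k + f (Suc (Suc k)) = 2 * cos \<theta> * f (Suc k)" for k
  proof -
    define \<phi> where "\<phi> = t + real (Suc k) * \<theta>"
    have shift: "t + real k * \<theta> = \<phi> - \<theta>" "t + real (Suc (Suc k)) * \<theta> = \<phi> + \<theta>"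
      by (simp_all add: \<phi>_def algebra_simps)
    have "f k + f (Suc (Suc k)) = Re (x - c) * (cos (\<phi> + \<theta>) + cos (\<phi> - \<theta>))
        + Im (x - c) * (sin (\<phi> + \<theta>) + sin (\<phi> - \<theta>))"
      unfolding f_def shift by (simp add: algebra_simps)
    also have "\<dots> = 2 * cos \<theta> * f (Suc k)"
      unfolding cos_add_cos_diff sin_add_sin_diff f_def \<phi>_def[symmetric]
      by (simp add: algebra_simps)
    finally show ?thesis .
  qed
  \<comment> \<open>Taking differences removes the constant part of \<open>D\<close>, which would
    break the recurrence of \<open>f\<close>.\<close>
  have D_rec: "(D (Suc k) - D k) + (D (Suc (Suc (Suc k))) - D (Suc (Suc k))) =
      2 * cos \<theta> * (D (Suc (Suc k)) - D (Suc k))" for k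
  proof -
    have "(D (Suc k) - D k) + (D (Suc (Suc (Suc k))) - D (Suc (Suc k))) =
        2 * r * ((f k + f (Suc (Suc k))) - (f (Suc k) + f (Suc (Suc (Suc k)))))"
      by (simp add: D_def algebra_simps)
    also have "\<dots> = 2 * cos \<theta> * (D (Suc (Suc k)) - D (Suc k))"
      unfolding f_rec by (simp add: D_def algebra_simps)
    finally show ?thesis .
  qed
  have dist_sq: "(dist x (P k))\<^sup>2 = D k" if "k < n" for k
  proof -
    define \<phi> where "\<phi> = t + real k * \<theta>"
    have "(dist x (P k))\<^sup>2 = (Re (x - c) - r * cos \<phi>)\<^sup>2 + (Im (x - c) - r * sin \<phi>)\<^sup>2"
      by (simp add: dist_norm P[OF that] cmod_power2 \<phi>_def diff_diff_eq)
    also have "\<dots> = (Re (x - c))\<^sup>2 + (Im (x - c))\<^sup>2 + r\<^sup>2 * ((sin \<phi>)\<^sup>2 + (cos \<phi>)\<^sup>2)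
        - 2 * r * (Re (x - c) * cos \<phi> + Im (x - c) * sin \<phi>)"
      by algebra
    also have "\<dots> = D k"
      unfolding sin_cos_squared_add D_def f_def cmod_power2 \<phi>_def by simp
    finally show ?thesis .
  qed
  have D_rat: "D k \<in> \<rat>" if "k < n" for k
    using rat that unfolding rational_distance_point_def dist_sq[OF that, symmetric]
    by (intro Rats_power) blast
  \<comment> \<open>The cases \<open>k = 0\<close> and \<open>k = 1\<close> together involve
    vertices 0 to 4; this is where \<open>n \<ge> 5\<close> enters.\<close>
  have D_step: "D (Suc (Suc k)) = D (Suc k)" if "k < 2" for k
  proof -
    have "D (Suc (Suc k)) - D (Suc k) = 0"
      using that assms(1)
      by (intro rational_recurrence_middle_zero[OF irr _ _ _ D_rec] Rats_diff D_rat) auto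
    then show ?thesis by simp
  qed
  have "f 1 = f 2" "f 2 = f 3"
    using D_step[of 0] D_step[of 1] r by (simp_all add: D_def numeral_2_eq_2 numeral_3_eq_3)
  moreover have "f 1 + f 3 = 2 * cos \<theta> * f 2"
    using f_rec[of 1] by (simp add: numeral_2_eq_2 numeral_3_eq_3)
  ultimately have "(2 * cos \<theta> - 2) * f 2 = 0" "f 1 = f 2"
    by (simp_all add: algebra_simps)
  \<comment> \<open>If \<open>cos \<theta>\<close> were 1, \<open>side\<close> would read 0 =
    1.\<close>
  moreover have "2 * cos \<theta> - 2 \<noteq> 0"
    using side by auto
  ultimately have f0: "f 2 = 0" "f 1 = 0"
    by auto
  define \<phi> where "\<phi> = t + \<theta>"
  have sin\<theta>: "sin \<theta> \<noteq> 0"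
  proof -
    have "0 < \<theta>" "\<theta> < pi"
      using assms(1) by (auto simp: \<theta>_def field_simps)
    then show ?thesis using sin_gt_zero by force
  qed
  \<comment> \<open>\<open>x - c\<close> is orthogonal to the directions of vertices 1 and 2, which
    are independent because \<open>sin \<theta>\<close> is nonzero.\<close>
  have "norm (x - c) = 0"
  proof -
    let ?a = "Re (x - c)" and ?b = "Im (x - c)"
    have 1: "?a * cos \<phi> + ?b * sin \<phi> = 0"
      using f0(2) by (simp add: f_def \<phi>_def)
    have "?a * cos (\<phi> + \<theta>) + ?b * sin (\<phi> + \<theta>) = 0"
      using f0(1) by (simp add: f_def \<phi>_def algebra_simps)
    then have "cos \<theta> * (?a * cos \<phi> + ?b * sin \<phi>) + sin \<theta> * (?b * cos \<phi> - ?a * sin \<phi>) = 0"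
      unfolding cos_add sin_add by (simp add: algebra_simps)
    with 1 sin\<theta> have 2: "?b * cos \<phi> - ?a * sin \<phi> = 0" by simp
    have "(norm (x - c))\<^sup>2 = (?a\<^sup>2 + ?b\<^sup>2) * ((sin \<phi>)\<^sup>2 + (cos \<phi>)\<^sup>2)"
      unfolding sin_cos_squared_add cmod_power2 by simp
    also have "\<dots> = (?a * cos \<phi> + ?b * sin \<phi>)\<^sup>2 + (?b * cos \<phi> - ?a * sin \<phi>)\<^sup>2"
      by algebra
    finally show ?thesis using 1 2 by simp
  qed
  \<comment> \<open>At the centre, \<open>D 1\<close> is just \<open>r\<^sup>2\<close>.\<close>
  with f0(2) D_rat[of 1] assms(1) have r2: "r\<^sup>2 \<in> \<rat>"
    by (simp add: D_def)
  from side r have "2 * cos \<theta> = 2 - 1 / r\<^sup>2"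
    by (simp add: field_simps)
  with r2 have "2 * cos \<theta> \<in> \<rat>" by simp
  with irr show False by contradiction
qed

lemma unit_hexagon_rational_distance_point:
  assumes "unit_regular_polygon 6 P"
  shows "\<exists>x. rational_distance_point 6 P x"
proof -
  from assms obtain c r t where r: "r > 0"
    and P: "\<And>k. k < 6 \<Longrightarrow> P k = c + of_real r * cis (t + real k * (2 * pi / real 6))"
    and side: "2 * r\<^sup>2 * (1 - cos (2 * pi / real 6)) = 1"
    by (rule unit_regular_polygonE) blast
  from side have "r\<^sup>2 = 1" by (simp add: cos_60)
  with r have "r = 1" by (simp add: power2_eq_1_iff)
  with P have "dist c (P k) = 1" if "k < 6" for k
    using that by (simp add: dist_norm)
  then have "rational_distance_point 6 P c"
    by (simp add: rational_distance_point_def)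
  then show ?thesis by blast
qed

theorem theorem1:
  "(\<forall>P. unit_regular_polygon 5 P \<longrightarrow> \<not> (\<exists>x. rational_distance_point 5 P x)) \<and>
   (\<forall>P. unit_regular_polygon 6 P \<longrightarrow> (\<exists>x. rational_distance_point 6 P x)) \<and>
   (\<forall>n P. n \<ge> 7 \<and> n \<notin> {8, 12, 24} \<and> unit_regular_polygon n P \<longrightarrow>
      \<not> (\<exists>x. rational_distance_point n P x))"
  using no_rational_distance_point unit_hexagon_rational_distance_point by auto

end
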